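(* Let $i\ge 0$ and let $K$ be a finite simplicial complex of dimension greater than $i$, equipped with an orientation $\sigma$. Then the largest eigenvalue of the $i$-th up normalized Laplacian satisfies $\lambda_{\max}(\Delta_i^{up}(K))=i+2$ if and only if $K$ contains an $(i+1)$-path connected component $K'$ such that the $i$-th signed incidence graph $(B_i(K'),\sigma)$ is balanced.
   Context: A (finite abstract) simplicial complex $K$ on a finite vertex set $V$ is a collection of subsets of $V$ closed under taking subsets; an $i$-face is an element of cardinality $i+1$, $S_i(K)$ is the set of $i$-faces, and facets are faces maximal under inclusion. An orientation $\sigma$ assigns to each face an ordering of its vertices, up to even permutations. For an $(i+1)$-face $\bar F$ with oriented form $[v_0,\dots,v_{i+1}]$ and $F=\bar F\setminus\{v_j\}$, set $\operatorname{sgn}([F],\partial[\bar F])=(-1)^j$ if the chosen orientation of $F$ agrees with $[v_0,\dots,\hat v_j,\dots,v_{i+1}]$ and $-(-1)^j$ otherwise; it is $0$ if $F\not\subset \bar F$. Normalized weights: $w$ is the positive function on faces with $w(F)=1$ for every facet $F$ and $w(F)=\sum_{\bar F\in S_{i+1}(K),\,F\subset\bar F} w(\bar F)$ for every $i$-face $F$ that is not a facet. The $i$-th up normalized Laplacian $\Delta_i^{up}(K)=\delta_i^*\delta_i$ (adjoint taken with respect to the inner products $(f,g)=\sum_{F\in S_i(K)}w(F)f(F)g(F)$ on functions on $i$-faces) acts on functions $f:S_i(K)\to\mathbb R$ by $(\Delta_i^{up}f)(F)=\sum_{\bar F\in S_{i+1}(K):F\subset\bar F}\frac{w(\bar F)}{w(F)}f(F)+\sum_{F'\in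 S_i(K):F'\neq F,\ F\cup F'=\bar F\in S_{i+1}(K)}\frac{w(\bar F)}{w(F)}\operatorname{sgn}([F],\partial[\bar F])\operatorname{sgn}([F'],\partial[\bar F])f(F')$. Its spectrum does not depend on the orientation, and all its eigenvalues lie in $[0,i+2]$. An $(i+1)$-path is a sequence of $(i+1)$-faces $\bar F_1,\dots,\bar F_m$ such that $\bar F_j\cap\bar F_l$ is an $i$-face if and only if $|j-l|=1$. $K$ is $(i+1)$-path connected if any two $(i+1)$-faces are joined by an $(i+1)$-path; an $(i+1)$-path connected component is a maximal $(i+1)$-path connected subcomplex under inclusion. The $i$-th signed incidence graph $(B_i(K),\sigma)$ is the bipartite graph with vertex set $S_i(K)\cup S_{i+1}(K)$, where $\{F,\bar F\}$ is an edge iff $F\subset\bar F$, with sign $\operatorname{sgn}([F],\partial[\bar F])$. A signed graph is balanced if every cycle has positive product of edge signs (this property of $B_i(K)$ does not depend on the orientation). *)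

theory Defs
  imports Complex_Main "HOL-Combinatorics.Permutations"
begin

definition simplicial_complex :: "'a set \<Rightarrow> 'a set set \<Rightarrow> bool" where
  "simplicial_complex V K \<longleftrightarrow>
     finite V \<and> K \<subseteq> Pow V \<and> (\<forall>F\<in>K. \<forall>G. G \<subseteq> F \<longrightarrow> G \<in> K)"

definition faces :: "'a set set \<Rightarrow> nat \<Rightarrow> 'a set set" where
  "faces K i = {F \<in> K. card F = i + 1}"

definition facet :: "'a set set \<Rightarrow> 'a set \<Rightarrow> bool" where
  "facet K F \<longleftrightarrow> F \<in> K \<and> (\<forall>G\<in>K. F \<subseteq> G \<longrightarrow> G = F)"

(* The inserted -1 only matters for the void complex (no faces at all), for which
   Max would otherwise be unspecified. *)
definition dimension :: "'a set set \<Rightarrow> int" where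
  "dimension K = Max (insert (-1) ((\<lambda>F. int (card F) - 1) ` K))"


definition orderings :: "'a set \<Rightarrow> 'a list set" where
  "orderings F = {xs. distinct xs \<and> set xs = F}"

definition even_related :: "'a set \<Rightarrow> ('a list \<times> 'a list) set" where
  "even_related F = {(xs, ys). xs \<in> orderings F \<and> ys \<in> orderings F \<and>
     (\<exists>p. p permutes F \<and> evenperm p \<and> ys = map p xs)}"

definition orientation :: "'a set set \<Rightarrow> ('a set \<Rightarrow> 'a list set) \<Rightarrow> bool" where
  "orientation K \<sigma> \<longleftrightarrow> (\<forall>F\<in>K. \<sigma> F \<in> orderings F // even_related F)"

(* sgn([F], d[G]) for an i-face F and an (i+1)-face G.  The value does not depend on
   the representative xs chosen from the orientation class of G. *)
definition incidence_sgn :: "('a set \<Rightarrow> 'a list set) \<Rightarrow> 'a set \<Rightarrow> 'a set \<Rightarrow> int" where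
  "incidence_sgn \<sigma> F G =
     (if F \<subset> G then
        let xs = (SOME xs. xs \<in> \<sigma> G);
            j = (THE j. j < length xs \<and> F = G - {xs ! j})
        in if take j xs @ drop (Suc j) xs \<in> \<sigma> F then (-1) ^ j else - ((-1) ^ j)
      else 0)"


(* An i-face F has card F = i + 1, so faces K (card F) is the set of (i+1)-faces.
   The value 0 off the complex is a dummy. *)
function weight :: "'a set set \<Rightarrow> 'a set \<Rightarrow> real" where
  "weight K F =
     (if finite K \<and> F \<in> K then
        if facet K F then 1 else (\<Sum>G\<in>{G \<in> faces K (card F). F \<subset> G}. weight K G)
      else 0)"
  by pat_completeness auto
termination
proof (relation "Wellfounded.measure (\<lambda>(K, F). Suc (Max (card ` K)) - card F)", goal_cases)
  case (2 K F G)
  then have "card G = Suc (card F)" and G: "finite K" "G \<in> K"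
    by (auto simp: faces_def)
  moreover from G have "card G \<le> Max (card ` K)" by simp
  ultimately show ?case by simp
qed simp

declare weight.simps [simp del]

definition up_laplacian ::
  "'a set set \<Rightarrow> ('a set \<Rightarrow> 'a list set) \<Rightarrow> nat \<Rightarrow> ('a set \<Rightarrow> real) \<Rightarrow> 'a set \<Rightarrow> real" where
  "up_laplacian K \<sigma> i f F =
     (\<Sum>G\<in>{G \<in> faces K (i + 1). F \<subset> G}. weight K G / weight K F * f F) +
     (\<Sum>F'\<in>{F' \<in> faces K i. F' \<noteq> F \<and> F \<union> F' \<in> faces K (i + 1)}.
        weight K (F \<union> F') / weight K F *
        of_int (incidence_sgn \<sigma> F (F \<union> F')) * of_int (incidence_sgn \<sigma> F' (F \<union> F')) * f F')"

(* Functions on i-faces are represented by total functions, of which only the values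
   on faces K i matter. *)
definition up_eigenvalue ::
  "'a set set \<Rightarrow> ('a set \<Rightarrow> 'a list set) \<Rightarrow> nat \<Rightarrow> real \<Rightarrow> bool" where
  "up_eigenvalue K \<sigma> i l \<longleftrightarrow>
     (\<exists>f. (\<exists>F\<in>faces K i. f F \<noteq> 0) \<and>
          (\<forall>F\<in>faces K i. up_laplacian K \<sigma> i f F = l * f F))"

definition lambda_max_up :: "'a set set \<Rightarrow> ('a set \<Rightarrow> 'a list set) \<Rightarrow> nat \<Rightarrow> real" where
  "lambda_max_up K \<sigma> i = (GREATEST l. up_eigenvalue K \<sigma> i l)"


(* The parameter i stands for (i+1)-paths, i.e. paths of (i+1)-faces through i-faces. *)
definition face_path :: "'a set set \<Rightarrow> nat \<Rightarrow> 'a set list \<Rightarrow> bool" where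
  "face_path K i Fs \<longleftrightarrow>
     Fs \<noteq> [] \<and> set Fs \<subseteq> faces K (i + 1) \<and>
     (\<forall>j<length Fs. \<forall>l<length Fs.
        Fs ! j \<inter> Fs ! l \<in> faces K i \<longleftrightarrow> (l = j + 1 \<or> j = l + 1))"

definition face_path_connected :: "'a set set \<Rightarrow> nat \<Rightarrow> bool" where
  "face_path_connected K i \<longleftrightarrow>
     (\<forall>F\<in>faces K (i + 1). \<forall>G\<in>faces K (i + 1).
        \<exists>Fs. face_path K i Fs \<and> hd Fs = F \<and> last Fs = G)"

definition face_path_component :: "'a set \<Rightarrow> 'a set set \<Rightarrow> nat \<Rightarrow> 'a set set \<Rightarrow> bool" where
  "face_path_component V K i L \<longleftrightarrow>
     simplicial_complex V L \<and> L \<subseteq> K \<and> face_path_connected L i \<and>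
     (\<forall>M. simplicial_complex V M \<and> M \<subseteq> K \<and> face_path_connected M i \<and> L \<subseteq> M \<longrightarrow> M = L)"


record 'v signed_graph =
  vertices :: "'v set"
  edges :: "'v set set"
  edge_sign :: "'v set \<Rightarrow> int"

definition graph_cycle :: "'v signed_graph \<Rightarrow> 'v list \<Rightarrow> bool" where
  "graph_cycle G vs \<longleftrightarrow>
     3 \<le> length vs \<and> distinct vs \<and> set vs \<subseteq> vertices G \<and>
     (\<forall>j<length vs. {vs ! j, vs ! (Suc j mod length vs)} \<in> edges G)"

definition balanced :: "'v signed_graph \<Rightarrow> bool" where
  "balanced G \<longleftrightarrow>
     (\<forall>vs. graph_cycle G vs \<longrightarrow>
        (\<Prod>j<length vs. edge_sign G {vs ! j, vs ! (Suc j mod length vs)}) > 0)"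

(* For an edge e = {F, G} with F \<subset> G, \<Inter>e = F and \<Union>e = G. *)
definition signed_incidence_graph ::
  "'a set set \<Rightarrow> ('a set \<Rightarrow> 'a list set) \<Rightarrow> nat \<Rightarrow> 'a set signed_graph" where
  "signed_incidence_graph K \<sigma> i =
     \<lparr> vertices = faces K i \<union> faces K (i + 1),
       edges = {{F, G} | F G. F \<in> faces K i \<and> G \<in> faces K (i + 1) \<and> F \<subset> G},
       edge_sign = (\<lambda>e. incidence_sgn \<sigma> (\<Inter>e) (\<Union>e)) \<rparr>"


text \<open>The explicit formula for the up Laplacian is indeed that of the composition of the
  coboundary operator with its adjoint for the weighted inner products.\<close>

definition coboundary ::
  "'a set set \<Rightarrow> ('a set \<Rightarrow> 'a list set) \<Rightarrow> nat \<Rightarrow> ('a set \<Rightarrow> real) \<Rightarrow> 'a set \<Rightarrow> real" where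
  "coboundary K \<sigma> i f G = (\<Sum>F\<in>faces K i. of_int (incidence_sgn \<sigma> F G) * f F)"

definition face_inner ::
  "'a set set \<Rightarrow> nat \<Rightarrow> ('a set \<Rightarrow> real) \<Rightarrow> ('a set \<Rightarrow> real) \<Rightarrow> real" where
  "face_inner K i f g = (\<Sum>F\<in>faces K i. weight K F * f F * g F)"

lemma finite_simplicial_complex: "simplicial_complex V K \<Longrightarrow> finite K"
  unfolding simplicial_complex_def by (meson finite_Pow_iff finite_subset)

lemma finite_faces: "simplicial_complex V K \<Longrightarrow> finite (faces K i)"
  by (simp add: faces_def finite_simplicial_complex)

lemma ex_coface:
  assumes K: "simplicial_complex V K" and F: "F \<in> K" "\<not> facet K F"
  shows "\<exists>G\<in>faces K (card F). F \<subset> G"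
proof -
  obtain H where H: "H \<in> K" "F \<subset> H" using F unfolding facet_def by blast
  then obtain v where v: "v \<in> H" "v \<notin> F" by blast
  have "finite F" using K F unfolding simplicial_complex_def by (meson PowD finite_subset subsetD)
  moreover have "insert v F \<in> K" using K H v unfolding simplicial_complex_def
    by (metis insert_subset psubset_imp_subset)
  ultimately show ?thesis using v by (intro bexI[of _ "insert v F"]) (auto simp: faces_def)
qed

lemma weight_pos:
  assumes K: "simplicial_complex V K"
  shows "F \<in> K \<Longrightarrow> weight K F > 0"
proof (induction "Suc (Max (card ` K)) - card F" arbitrary: F rule: less_induct)
  case less
  have fin: "finite K" using K finite_simplicial_complex by blast
  have IH: "weight K G > 0" if "G \<in> {G \<in> faces K (card F). F \<subset> G}" for G
  proof (rule less.hyps)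
    show GK: "G \<in> K" using that by (auto simp: faces_def)
    have "card G \<le> Max (card ` K)" using fin GK by simp
    then show "Suc (Max (card ` K)) - card G < Suc (Max (card ` K)) - card F"
      using that by (simp add: faces_def)
  qed
  have "(\<Sum>G\<in>{G \<in> faces K (card F). F \<subset> G}. weight K G) > 0" if "\<not> facet K F"
    using ex_coface[OF K less.prems that] IH
    by (intro sum_pos) (auto simp: finite_faces[OF K])
  then show ?case using fin less.prems by (subst weight.simps) auto
qed

lemma incidence_sgn_square: "F \<subset> G \<Longrightarrow> incidence_sgn \<sigma> F G * incidence_sgn \<sigma> F G = 1"
  by (simp add: incidence_sgn_def Let_def flip: power_mult_distrib)

lemma up_laplacian_adjoint:
  assumes K: "simplicial_complex V K"
  shows "face_inner K i (up_laplacian K \<sigma> i f) g =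
         face_inner K (i + 1) (coboundary K \<sigma> i f) (coboundary K \<sigma> i g)"
proof -
  let ?s = "\<lambda>F G. of_int (incidence_sgn \<sigma> F G) :: real"
  let ?S = "faces K i" and ?T = "faces K (i + 1)"
  have fin: "finite ?S" "finite ?T" by (rule finite_faces[OF K])+
  have *: "weight K F * up_laplacian K \<sigma> i f F =
        (\<Sum>G\<in>?T. weight K G * ?s F G * coboundary K \<sigma> i f G)" if F: "F \<in> ?S" for F
  proof -
    let ?C = "{G \<in> ?T. F \<subset> G}"
    let ?N = "{F' \<in> ?S. F' \<noteq> F \<and> F \<union> F' \<in> ?T}"
    have w: "weight K F \<noteq> 0" using weight_pos[OF K] F by (force simp: faces_def)
    have finf: "finite A" if "A \<in> K" for A
      using K that unfolding simplicial_complex_def by (meson PowD finite_subset subsetD)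
    have "(\<Sum>G\<in>?T. weight K G * ?s F G * coboundary K \<sigma> i f G) =
          (\<Sum>G\<in>?C. weight K G * ?s F G * coboundary K \<sigma> i f G)"
      by (rule sum.mono_neutral_right) (auto simp: finite_faces[OF K] incidence_sgn_def)
    also have "\<dots> = (\<Sum>G\<in>?C. weight K G * f F +
        (\<Sum>F'\<in>{F'\<in>?S. F' \<noteq> F \<and> F' \<subset> G}. weight K G * ?s F G * ?s F' G * f F'))"
    proof (rule sum.cong[OF refl])
      fix G assume G: "G \<in> ?C"
      have "coboundary K \<sigma> i f G = ?s F G * f F + (\<Sum>F'\<in>?S - {F}. ?s F' G * f F')"
        unfolding coboundary_def by (rule sum.remove[OF fin(1) F])
      also have "(\<Sum>F'\<in>?S - {F}. ?s F' G * f F') =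
          (\<Sum>F'\<in>{F'\<in>?S. F' \<noteq> F \<and> F' \<subset> G}. ?s F' G * f F')"
        by (rule sum.mono_neutral_right) (auto simp: finite_faces[OF K] incidence_sgn_def)
      finally have c: "coboundary K \<sigma> i f G = ?s F G * f F +
          (\<Sum>F'\<in>{F'\<in>?S. F' \<noteq> F \<and> F' \<subset> G}. ?s F' G * f F')" .
      have sq: "?s F G * (?s F G * x) = x" for x
        using incidence_sgn_square[of F G \<sigma>] G
        by (metis (no_types, lifting) mem_Collect_eq mult.assoc mult_1 of_int_1 of_int_mult)
      show "weight K G * ?s F G * coboundary K \<sigma> i f G = weight K G * f F +
        (\<Sum>F'\<in>{F'\<in>?S. F' \<noteq> F \<and> F' \<subset> G}. weight K G * ?s F G * ?s F' G * f F')"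
        unfolding c by (simp add: distrib_left sum_distrib_left mult.assoc sq)
    qed
    also have "\<dots> = (\<Sum>G\<in>?C. weight K G * f F) +
        (\<Sum>(G, F')\<in>(SIGMA G:?C. {F'\<in>?S. F' \<noteq> F \<and> F' \<subset> G}).
           weight K G * ?s F G * ?s F' G * f F')"
      by (simp add: sum.distrib sum.Sigma finite_faces[OF K])
    also have "(\<Sum>(G, F')\<in>(SIGMA G:?C. {F'\<in>?S. F' \<noteq> F \<and> F' \<subset> G}).
           weight K G * ?s F G * ?s F' G * f F') =
        (\<Sum>F'\<in>?N. weight K (F \<union> F') * ?s F (F \<union> F') * ?s F' (F \<union> F') * f F')"
    proof -
      have un: "F \<union> F' = G" if "F' \<in> ?S" "F' \<noteq> F" "G \<in> ?T" "F \<subset> G" "F' \<subset> G" for F' G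
      proof (rule card_seteq)
        show "finite G" using that finf by (auto simp: faces_def)
        show "F \<union> F' \<subseteq> G" using that by blast
        have "finite F'" "card F = card F'" using that F finf by (auto simp: faces_def)
        then have "\<not> F' \<subseteq> F" using that F finf card_subset_eq by (metis card_ge_0_finite
              F faces_def mem_Collect_eq)
        then have "card F < card (F \<union> F')"
          using F that finf by (intro psubset_card_mono) (auto simp: faces_def)
        then show "card G \<le> card (F \<union> F')" using F that by (simp add: faces_def)
      qed
      have sub: "F \<subset> F \<union> F' \<and> F' \<subset> F \<union> F'" if "F' \<in> ?N" for F'
        using that F by (auto simp: faces_def)
      show ?thesis
        by (rule sum.reindex_bij_witness[of _ "\<lambda>F'. (F \<union> F', F')" snd])
          (use un sub in \<open>fastforce+\<close>)
    qed
    also have "(\<Sum>G\<in>?C. weight K G * f F) +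
        (\<Sum>F'\<in>?N. weight K (F \<union> F') * ?s F (F \<union> F') * ?s F' (F \<union> F') * f F') =
        weight K F * up_laplacian K \<sigma> i f F"
      using w by (simp add: up_laplacian_def distrib_left sum_distrib_left)
    finally show ?thesis by simp
  qed
  have "face_inner K i (up_laplacian K \<sigma> i f) g =
      (\<Sum>F\<in>?S. \<Sum>G\<in>?T. weight K G * ?s F G * coboundary K \<sigma> i f G * g F)"
    unfolding face_inner_def by (rule sum.cong) (simp_all add: * sum_distrib_right)
  also have "\<dots> = (\<Sum>G\<in>?T. \<Sum>F\<in>?S. weight K G * ?s F G * coboundary K \<sigma> i f G * g F)"
    by (rule sum.swap)
  also have "\<dots> = face_inner K (i + 1) (coboundary K \<sigma> i f) (coboundary K \<sigma> i g)"
    unfolding face_inner_def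
    by (rule sum.cong) (simp_all add: coboundary_def[of K \<sigma> i g] sum_distrib_left mult_ac)
  finally show ?thesis .
qed

end

theory Submission
  imports "HOL-Analysis.Function_Topology" Defs
begin

text \<open>The largest eigenvalue is the maximum of the Rayleigh quotient of the coboundary \<open>\<delta>\<close>. Since an
  \<open>(i+1)\<close>-face has \<open>i + 2\<close> faces, Cauchy-Schwarz bounds it by \<open>i + 2\<close>, with equality iff some nonzero
  \<open>f\<close> vanishes on facets and satisfies \<open>sgn([F], \<partial>[G]) f(F) = c(G)\<close> whenever \<open>F \<subset> G\<close>. Then \<open>c\<close> is
  nonzero throughout some path component, where \<open>(f, c)\<close> is a switching function whose existence
  means balance. Conversely, a switching function of a balanced component extends by zero, because by
  maximality no \<open>(i+1)\<close>-face outside the component shares an \<open>i\<close>-face with one inside.\<close>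

section \<open>The largest eigenvalue as a maximal Rayleigh quotient\<close>

lemma coboundary_cong:
  "(\<And>F. F \<in> faces K i \<Longrightarrow> f F = g F) \<Longrightarrow> coboundary K \<sigma> i f = coboundary K \<sigma> i g"
  by (auto simp: coboundary_def fun_eq_iff intro!: sum.cong)

lemma coboundary_add_scale:
  "coboundary K \<sigma> i (\<lambda>F. f F + t * g F) G = coboundary K \<sigma> i f G + t * coboundary K \<sigma> i g G"
  by (simp add: coboundary_def sum.distrib sum_distrib_left algebra_simps)

lemma face_inner_add_scale:
  "face_inner K i (\<lambda>F. f F + t * g F) (\<lambda>F. f F + t * g F) =
     face_inner K i f f + 2 * t * face_inner K i f g + t\<^sup>2 * face_inner K i g g"
  by (simp add: face_inner_def sum.distrib sum_distrib_left algebra_simps power2_eq_square)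

lemma face_inner_cong:
  "(\<And>F. F \<in> faces K i \<Longrightarrow> f F = f' F) \<Longrightarrow> (\<And>F. F \<in> faces K i \<Longrightarrow> g F = g' F) \<Longrightarrow>
     face_inner K i f g = face_inner K i f' g'"
  by (auto simp: face_inner_def intro!: sum.cong)

text \<open>Pairing with an indicator turns an identity between inner products into a pointwise one;
  the weight is then cancelled by positivity.\<close>

lemma face_inner_indicator:
  assumes "simplicial_complex V K" "F \<in> faces K i"
  shows "face_inner K i f (\<lambda>F'. if F' = F then 1 else 0) = weight K F * f F"
proof -
  have "face_inner K i f (\<lambda>F'. if F' = F then 1 else 0) =
      (\<Sum>F'\<in>faces K i. if F = F' then weight K F' * f F' else 0)"
    unfolding face_inner_def by (rule sum.cong) auto
  then show ?thesis using assms finite_faces[OF assms(1)] by simp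
qed

lemma weight_faces_pos: "simplicial_complex V K \<Longrightarrow> F \<in> faces K i \<Longrightarrow> weight K F > 0"
  using weight_pos by (auto simp: faces_def)

lemma face_inner_self_pos:
  assumes "simplicial_complex V K" "F \<in> faces K i" "f F \<noteq> 0"
  shows "face_inner K i f f > 0"
  unfolding face_inner_def
proof (rule sum_pos2[OF finite_faces[OF assms(1)] assms(2)])
  have "weight K F * (f F * f F) > 0"
    using weight_faces_pos[OF assms(1,2)] assms(3) by (auto simp: zero_less_mult_iff)
  then show "0 < weight K F * f F * f F" by (simp add: mult.assoc)
next
  fix F' assume "F' \<in> faces K i"
  then have "weight K F' > 0" using weight_faces_pos[OF assms(1)] by blast
  then have "weight K F' * (f F' * f F') \<ge> 0" by simp
  then show "0 \<le> weight K F' * f F' * f F'" by (simp add: mult.assoc)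
qed

text \<open>A small \<open>t\<close> of sign opposite to \<open>b\<close> lets the linear term win.
  Applied to a perturbation of a maximiser, this is the first-order condition.\<close>

lemma linear_coeff_zero:
  fixes a b :: real
  assumes "\<And>t. 0 \<le> 2 * t * b + t\<^sup>2 * a"
  shows "b = 0"
proof (rule ccontr)
  assume b: "b \<noteq> 0"
  \<comment> \<open>\<open>c\<close> is a positive strict upper bound for \<open>a\<close>; at
    \<open>t = - b / c\<close> the quadratic is then below \<open>- (b\<^sup>2 / c)\<close>.\<close>
  define c where "c = \<bar>a\<bar> + 1"
  have c: "c > 0" "a < c" unfolding c_def by auto
  have "0 \<le> 2 * (- b / c) * b + (- b / c)\<^sup>2 * a" by (rule assms)
  also have "\<dots> < 2 * (- b / c) * b + (- b / c)\<^sup>2 * c"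
    using b c by (intro add_strict_left_mono mult_strict_left_mono) auto
  also have "\<dots> = - (b\<^sup>2 / c)" using c by (simp add: field_simps power2_eq_square)
  also have "\<dots> \<le> 0" using c by simp
  finally show False by simp
qed

text \<open>Functions are total, so the sphere sits in a product of intervals over \<open>S\<close>
  and of the point 0 elsewhere. That product is compact by Tychonoff, and the sphere is closed in
  it.\<close>

lemma compact_unit_functions:
  fixes S :: "'b set"
  assumes "finite S"
  shows "compact {f :: 'b \<Rightarrow> real. (\<forall>x. x \<notin> S \<longrightarrow> f x = 0) \<and> (\<Sum>x\<in>S. (f x)\<^sup>2) = 1}" (is "compact ?T")
proof -
  let ?B = "PiE UNIV (\<lambda>x. if x \<in> S then {-1..1} else {0 :: real})"
  have "compactin (product_topology (\<lambda>_. euclidean) UNIV) ?B"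
    by (auto simp: compactin_PiE)
  then have B: "compact ?B" by (simp add: euclidean_product_topology)
  have cont: "continuous_on UNIV (\<lambda>f :: 'b \<Rightarrow> real. \<Sum>x\<in>S. (f x)\<^sup>2)"
    by (intro continuous_intros continuous_on_product_coordinates)
  have "closed ((\<lambda>f :: 'b \<Rightarrow> real. \<Sum>x\<in>S. (f x)\<^sup>2) -` {1})"
    using cont by (intro closed_vimage) auto
  then have "compact (?B \<inter> ((\<lambda>f :: 'b \<Rightarrow> real. \<Sum>x\<in>S. (f x)\<^sup>2) -` {1}))"
    by (rule compact_Int_closed[OF B])
  moreover have "?B \<inter> ((\<lambda>f :: 'b \<Rightarrow> real. \<Sum>x\<in>S. (f x)\<^sup>2) -` {1}) = ?T"
  proof -
    have "-1 \<le> f x \<and> f x \<le> 1" if "(\<Sum>x\<in>S. (f x)\<^sup>2) = 1" "x \<in> S" for f :: "'b \<Rightarrow> real" and x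
    proof -
      have "(f x)\<^sup>2 \<le> (\<Sum>x\<in>S. (f x)\<^sup>2)"
        by (rule member_le_sum) (use that assms in auto)
      then have "\<bar>f x\<bar> \<le> 1" using that by (simp add: abs_square_le_1)
      then show ?thesis by auto
    qed
    then show ?thesis by (fastforce simp: PiE_iff split: if_splits)
  qed
  ultimately show ?thesis by simp
qed

text \<open>The quotient is continuous on a compact sphere and hence attains its maximum; both forms
  are quadratic, so the bound carries over to all multiples.\<close>

lemma max_rayleigh_quotient:
  assumes K: "simplicial_complex V K" and ne: "faces K i \<noteq> {}"
  obtains f l where "\<exists>F\<in>faces K i. f F \<noteq> 0"
    "face_inner K (i + 1) (coboundary K \<sigma> i f) (coboundary K \<sigma> i f) = l * face_inner K i f f"
    "\<And>g. face_inner K (i + 1) (coboundary K \<sigma> i g) (coboundary K \<sigma> i g) \<le> l * face_inner K i g g"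
proof -
  let ?S = "faces K i"
  let ?Q = "\<lambda>f. face_inner K (i + 1) (coboundary K \<sigma> i f) (coboundary K \<sigma> i f)"
  let ?N = "\<lambda>f. face_inner K i f f"
  \<comment> \<open>The plain Euclidean sphere is enough: it meets every ray of functions supported
    on \<open>?S\<close>, and the weighted norm is positive on it.\<close>
  define T where "T = {f :: 'a set \<Rightarrow> real. (\<forall>F. F \<notin> ?S \<longrightarrow> f F = 0) \<and> (\<Sum>F\<in>?S. (f F)\<^sup>2) = 1}"
  have fin: "finite ?S" by (rule finite_faces[OF K])
  have nz: "\<exists>F\<in>?S. f F \<noteq> 0" if "f \<in> T" for f
  proof (rule ccontr)
    assume "\<not> (\<exists>F\<in>?S. f F \<noteq> 0)"
    then have "(\<Sum>F\<in>?S. (f F)\<^sup>2) = 0" by simp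
    then show False using that by (simp add: T_def)
  qed
  then have N: "?N f > 0" if "f \<in> T" for f
    using face_inner_self_pos[OF K] that by blast
  obtain F0 where F0: "F0 \<in> ?S" using ne by blast
  have "(\<Sum>F\<in>?S. (if F = F0 then 1 else 0 :: real)\<^sup>2) = (\<Sum>F\<in>?S. if F0 = F then 1 else 0)"
    by (rule sum.cong) auto
  then have "(\<lambda>F. if F = F0 then 1 else 0) \<in> T" using F0 fin by (auto simp: T_def)
  then have ne_T: "T \<noteq> {}" by blast
  have compact: "compact T" unfolding T_def by (rule compact_unit_functions[OF fin])
  have cont: "continuous_on T (\<lambda>f. ?Q f / ?N f)"
  proof (rule continuous_on_divide)
    have coord: "continuous_on T (\<lambda>f. f F)" for F
      by (rule continuous_on_subset[OF continuous_on_product_coordinates subset_UNIV])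
    show "continuous_on T ?Q" "continuous_on T ?N"
      unfolding face_inner_def coboundary_def
      by (intro continuous_on_sum continuous_on_mult continuous_on_const coord)+
    show "\<forall>f\<in>T. ?N f \<noteq> 0" by (intro ballI) (drule N, simp)
  qed
  obtain f where f: "f \<in> T" and max: "\<And>g. g \<in> T \<Longrightarrow> ?Q g / ?N g \<le> ?Q f / ?N f"
    using continuous_attains_sup[OF compact ne_T cont] by blast
  show thesis
  proof (rule that[of f "?Q f / ?N f"])
    show "\<exists>F\<in>faces K i. f F \<noteq> 0" by (rule nz[OF f])
    show "?Q f = ?Q f / ?N f * ?N f" using N[OF f] by simp
    fix g
    show "?Q g \<le> ?Q f / ?N f * ?N g"
    proof (cases "\<exists>F\<in>?S. g F \<noteq> 0")
      case False
      then have "?N g = 0" "?Q g = 0" by (simp_all add: face_inner_def coboundary_def)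
      then show ?thesis by simp
    next
      case True
      define r where "r = sqrt (\<Sum>F\<in>?S. (g F)\<^sup>2)"
      have "(\<Sum>F\<in>?S. (g F)\<^sup>2) > 0"
        using True fin by (auto intro: sum_pos2)
      then have r: "r > 0" "r\<^sup>2 = (\<Sum>F\<in>?S. (g F)\<^sup>2)" unfolding r_def by auto
      \<comment> \<open>\<open>g\<close> may be arbitrary off \<open>?S\<close>, where neither form
        looks; its normalisation is set to 0 there to land in \<open>T\<close>.\<close>
      define h where "h = (\<lambda>F. if F \<in> ?S then g F / r else 0)"
      have "(\<Sum>F\<in>?S. (h F)\<^sup>2) = (\<Sum>F\<in>?S. (g F)\<^sup>2 / r\<^sup>2)"
        by (rule sum.cong) (auto simp: h_def power_divide)
      also have "\<dots> = 1" using r(1) by (simp add: sum_divide_distrib[symmetric] r(2)[symmetric])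
      finally have h: "h \<in> T" by (auto simp: T_def h_def)
      \<comment> \<open>The summand 0 gives the shape \<open>f F + t * g F\<close> of the expansion
        lemmas.\<close>
      have gh: "g F = 0 + r * h F" if "F \<in> ?S" for F using that r by (simp add: h_def)
      have Ng: "?N g = r\<^sup>2 * ?N h"
        using face_inner_add_scale[of K i "\<lambda>_. 0" r h]
        by (simp add: face_inner_cong[OF gh gh]) (simp add: face_inner_def)
      have Qg: "?Q g = r\<^sup>2 * ?Q h"
      proof -
        have "coboundary K \<sigma> i g = coboundary K \<sigma> i (\<lambda>F. 0 + r * h F)"
          by (rule coboundary_cong) (rule gh)
        also have "\<dots> = (\<lambda>G. 0 + r * coboundary K \<sigma> i h G)"
          unfolding coboundary_add_scale by (simp add: coboundary_def)
        finally show ?thesis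
          using face_inner_add_scale[of K "i + 1" "\<lambda>_. 0" r "coboundary K \<sigma> i h"]
          by (simp add: face_inner_def)
      qed
      have "?Q h \<le> ?Q f / ?N f * ?N h"
        using max[OF h] N[OF h] by (simp add: field_simps)
      then have "r\<^sup>2 * ?Q h \<le> r\<^sup>2 * (?Q f / ?N f * ?N h)"
        by (rule mult_left_mono) simp
      then show ?thesis unfolding Ng Qg by (simp only: mult.left_commute)
    qed
  qed
qed

text \<open>At a maximiser of the Rayleigh quotient the first variation vanishes, which is the
  eigenvalue equation in weak form; conversely each eigenvalue is a Rayleigh quotient. So the
  \<open>GREATEST\<close> in \<open>lambda_max_up\<close> exists and is the maximum.\<close>

lemma lambda_max_up_max_rayleigh:
  assumes K: "simplicial_complex V K" and ne: "faces K i \<noteq> {}"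
  shows "\<exists>f. (\<exists>F\<in>faces K i. f F \<noteq> 0) \<and>
      face_inner K (i + 1) (coboundary K \<sigma> i f) (coboundary K \<sigma> i f) =
        lambda_max_up K \<sigma> i * face_inner K i f f" (is ?A)
    and "face_inner K (i + 1) (coboundary K \<sigma> i g) (coboundary K \<sigma> i g) \<le>
        lambda_max_up K \<sigma> i * face_inner K i g g" (is ?B)
proof -
  let ?Q = "\<lambda>f. face_inner K (i + 1) (coboundary K \<sigma> i f) (coboundary K \<sigma> i f)"
  let ?N = "\<lambda>f. face_inner K i f f"
  obtain f l where f: "\<exists>F\<in>faces K i. f F \<noteq> 0" "?Q f = l * ?N f"
    and le: "\<And>g. ?Q g \<le> l * ?N g"
    using max_rayleigh_quotient[OF K ne] by blast
  have crit: "l * face_inner K i f g = face_inner K i (up_laplacian K \<sigma> i f) g" for g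
  proof -
    let ?b = "l * face_inner K i f g - face_inner K (i + 1) (coboundary K \<sigma> i f) (coboundary K \<sigma> i g)"
    \<comment> \<open>Equality holds at \<open>f\<close>, so the constant term of the defect at
      \<open>f + t g\<close> cancels and a nonnegative quadratic in \<open>t\<close> without
      constant term remains.\<close>
    have "0 \<le> 2 * t * ?b + t\<^sup>2 * (l * ?N g - ?Q g)" for t
      using le[of "\<lambda>F. f F + t * g F"] f(2)
      unfolding coboundary_add_scale face_inner_add_scale
      by (simp add: algebra_simps)
    then have "?b = 0" by (rule linear_coeff_zero)
    then show ?thesis by (simp add: up_laplacian_adjoint[OF K])
  qed
  have "up_laplacian K \<sigma> i f F = l * f F" if F: "F \<in> faces K i" for F
    using crit[of "\<lambda>F'. if F' = F then 1 else 0"] weight_faces_pos[OF K F]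
    unfolding face_inner_indicator[OF K F] by simp
  with f(1) have "up_eigenvalue K \<sigma> i l" unfolding up_eigenvalue_def by blast
  moreover have "m \<le> l" if "up_eigenvalue K \<sigma> i m" for m
  proof -
    obtain h where h: "\<exists>F\<in>faces K i. h F \<noteq> 0"
      "\<And>F. F \<in> faces K i \<Longrightarrow> up_laplacian K \<sigma> i h F = m * h F"
      using \<open>up_eigenvalue K \<sigma> i m\<close> unfolding up_eigenvalue_def by blast
    have "m * ?N h = face_inner K i (up_laplacian K \<sigma> i h) h"
      using h(2) by (simp add: face_inner_def sum_distrib_left mult_ac cong: sum.cong)
    also have "\<dots> = ?Q h" by (rule up_laplacian_adjoint[OF K])
    also have "\<dots> \<le> l * ?N h" by (rule le)
    finally show "m \<le> l" using h(1) face_inner_self_pos[OF K] by auto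
  qed
  ultimately have "lambda_max_up K \<sigma> i = l"
    unfolding lambda_max_up_def by (rule Greatest_equality)
  then show ?A ?B using f le by auto
qed

section \<open>The energy identity\<close>

lemma finite_face: "simplicial_complex V K \<Longrightarrow> F \<in> K \<Longrightarrow> finite F"
  unfolding simplicial_complex_def by (meson PowD finite_subset subsetD)

text \<open>Closure under subsets makes every subset of \<open>G\<close> of size
  \<open>i + 1\<close> a face. This count is the source of the bound \<open>i + 2\<close>.\<close>

lemma card_subfaces:
  assumes K: "simplicial_complex V K" and G: "G \<in> faces K (i + 1)"
  shows "card {F \<in> faces K i. F \<subset> G} = i + 2"
proof -
  have GK: "G \<in> K" "card G = i + 2" "finite G"
    using G finite_face[OF K] by (auto simp: faces_def)
  have "{F \<in> faces K i. F \<subset> G} = {F. F \<subseteq> G \<and> card F = i + 1}"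
    using GK K unfolding faces_def simplicial_complex_def by auto
  then show ?thesis using n_subsets[OF GK(3), of "i + 1"] GK by simp
qed

text \<open>The Cauchy-Schwarz defect is a multiple of the variance: it vanishes only when all
  values equal their mean.\<close>

lemma sum_square_mean:
  fixes a :: "'b \<Rightarrow> real"
  assumes "finite A" "card A = n" "n > 0"
  shows "real n * (\<Sum>x\<in>A. (a x)\<^sup>2) - (\<Sum>x\<in>A. a x)\<^sup>2 =
    real n * (\<Sum>x\<in>A. (a x - (\<Sum>y\<in>A. a y) / real n)\<^sup>2)"
proof -
  let ?m = "(\<Sum>y\<in>A. a y) / real n"
  have "(\<Sum>x\<in>A. (a x - m)\<^sup>2) = (\<Sum>x\<in>A. (a x)\<^sup>2) - 2 * m * (\<Sum>x\<in>A. a x) + real n * m\<^sup>2" for m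
  proof -
    have "(\<Sum>x\<in>A. (a x - m)\<^sup>2) = (\<Sum>x\<in>A. (a x)\<^sup>2 - 2 * m * a x + m\<^sup>2)"
      by (rule sum.cong) (auto simp: power2_diff)
    also have "\<dots> = (\<Sum>x\<in>A. (a x)\<^sup>2) - (\<Sum>x\<in>A. 2 * m * a x) + real n * m\<^sup>2"
      using assms by (simp add: sum.distrib sum_subtractf)
    finally show ?thesis by (simp only: sum_distrib_left)
  qed
  from this[of ?m] show ?thesis using assms by (simp add: field_simps power2_eq_square)
qed

lemma incidence_sgn_power2: "F \<subset> G \<Longrightarrow> (of_int (incidence_sgn \<sigma> F G) :: real)\<^sup>2 = 1"
  using incidence_sgn_square[of F G \<sigma>] by (metis of_int_1 of_int_mult power2_eq_square)

text \<open>Every non-facet has the total weight of its cofaces, so that the upper bound is lost exactly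
  at the facets and in the Cauchy-Schwarz inequality on each coface.\<close>

lemma energy_identity:
  fixes \<sigma> :: "'a set \<Rightarrow> 'a list set" and i :: nat
  assumes K: "simplicial_complex V K"
  defines "d \<equiv> coboundary K \<sigma> i"
  shows "real (i + 2) * face_inner K i f f - face_inner K (i + 1) (d f) (d f) =
    real (i + 2) * ((\<Sum>F\<in>{F \<in> faces K i. facet K F}. weight K F * (f F)\<^sup>2) +
      (\<Sum>G\<in>faces K (i + 1). weight K G *
        (\<Sum>F\<in>{F \<in> faces K i. F \<subset> G}. (of_int (incidence_sgn \<sigma> F G) * f F - d f G / real (i + 2))\<^sup>2)))"
proof -
  let ?S = "faces K i" and ?T = "faces K (i + 1)"
  let ?s = "\<lambda>F G. of_int (incidence_sgn \<sigma> F G) :: real"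
  let ?sub = "\<lambda>G. {F \<in> ?S. F \<subset> G}"
  have fin: "finite ?S" "finite ?T" by (rule finite_faces[OF K])+
  have d: "d f G = (\<Sum>F\<in>?sub G. ?s F G * f F)" if "G \<in> ?T" for G
    unfolding d_def coboundary_def
    by (rule sum.mono_neutral_right) (auto simp: fin incidence_sgn_def)
  \<comment> \<open>The signs square to 1, so they may be inserted into the squared norm; the mean
    of the signed values is \<open>d f G / real (i + 2)\<close>.\<close>
  have local: "real (i + 2) * (\<Sum>F\<in>?sub G. (f F)\<^sup>2) - (d f G)\<^sup>2 =
      real (i + 2) * (\<Sum>F\<in>?sub G. (?s F G * f F - d f G / real (i + 2))\<^sup>2)" if G: "G \<in> ?T" for G
  proof -
    have "(\<Sum>F\<in>?sub G. (f F)\<^sup>2) = (\<Sum>F\<in>?sub G. (?s F G * f F)\<^sup>2)"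
      by (rule sum.cong) (auto simp: power_mult_distrib incidence_sgn_power2)
    then show ?thesis
      unfolding d[OF G] using sum_square_mean[of "?sub G" "i + 2" "\<lambda>F. ?s F G * f F"]
      by (simp add: fin card_subfaces[OF K G])
  qed
  have w: "weight K F = (\<Sum>G\<in>{G \<in> ?T. F \<subset> G}. weight K G)" if "F \<in> ?S" "\<not> facet K F" for F
    using that finite_simplicial_complex[OF K] by (subst weight.simps) (auto simp: faces_def)
  have facet: "{G \<in> ?T. F \<subset> G} = {}" if "facet K F" for F
    using that unfolding facet_def faces_def by blast
  have "face_inner K i f f = (\<Sum>F\<in>?S. weight K F * (f F)\<^sup>2)"
    by (simp add: face_inner_def power2_eq_square mult.assoc)
  \<comment> \<open>One formula covers both cases, since the coface sum of a facet is empty;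
    exchanging the sums then regroups the norm by cofaces.\<close>
  also have "\<dots> = (\<Sum>F\<in>?S. (if facet K F then weight K F * (f F)\<^sup>2 else 0) +
      (\<Sum>G\<in>{G \<in> ?T. F \<subset> G}. weight K G * (f F)\<^sup>2))"
  proof (rule sum.cong[OF refl])
    fix F assume F: "F \<in> ?S"
    show "weight K F * (f F)\<^sup>2 = (if facet K F then weight K F * (f F)\<^sup>2 else 0) +
      (\<Sum>G\<in>{G \<in> ?T. F \<subset> G}. weight K G * (f F)\<^sup>2)"
    proof (cases "facet K F")
      case True
      then show ?thesis by (simp only: facet sum.empty if_True add_0_right)
    next
      case False
      then show ?thesis by (simp only: w[OF F False] sum_distrib_right if_False add_0_left)
    qed
  qed
  also have "\<dots> = (\<Sum>F\<in>{F \<in> ?S. facet K F}. weight K F * (f F)\<^sup>2) +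
      (\<Sum>F\<in>?S. \<Sum>G\<in>{G \<in> ?T. F \<subset> G}. weight K G * (f F)\<^sup>2)"
    by (simp add: sum.distrib sum.inter_filter fin)
  also have "(\<Sum>F\<in>?S. \<Sum>G\<in>{G \<in> ?T. F \<subset> G}. weight K G * (f F)\<^sup>2) =
      (\<Sum>G\<in>?T. \<Sum>F\<in>?sub G. weight K G * (f F)\<^sup>2)"
    by (rule sum.swap_restrict[OF fin])
  finally have N: "face_inner K i f f = (\<Sum>F\<in>{F \<in> ?S. facet K F}. weight K F * (f F)\<^sup>2) +
      (\<Sum>G\<in>?T. weight K G * (\<Sum>F\<in>?sub G. (f F)\<^sup>2))"
    by (simp add: sum_distrib_left)
  have comb: "r * (\<Sum>G\<in>?T. weight K G * u G) - (\<Sum>G\<in>?T. weight K G * e G * e G) =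
     (\<Sum>G\<in>?T. weight K G * (r * u G - (e G)\<^sup>2))" for r u e
    by (simp add: sum_distrib_left right_diff_distrib sum_subtractf power2_eq_square mult_ac)
  have "real (i + 2) * (\<Sum>G\<in>?T. weight K G * (\<Sum>F\<in>?sub G. (f F)\<^sup>2)) - face_inner K (i + 1) (d f) (d f) =
     (\<Sum>G\<in>?T. weight K G * (real (i + 2) * (\<Sum>F\<in>?sub G. (f F)\<^sup>2) - (d f G)\<^sup>2))"
    unfolding face_inner_def by (rule comb)
  also have "\<dots> = (\<Sum>G\<in>?T. weight K G * (real (i + 2) * (\<Sum>F\<in>?sub G. (?s F G * f F - d f G / real (i + 2))\<^sup>2)))"
    by (rule sum.cong[OF refl]) (simp only: local)
  also have "\<dots> = real (i + 2) * (\<Sum>G\<in>?T. weight K G * (\<Sum>F\<in>?sub G. (?s F G * f F - d f G / real (i + 2))\<^sup>2))"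
    by (simp only: sum_distrib_left mult.left_commute)
  finally show ?thesis unfolding N by (simp only: distrib_left)
qed

text \<open>All terms of the energy identity are nonnegative, so \<open>i + 2\<close> bounds every
  Rayleigh quotient and is attained exactly when some nonzero \<open>f\<close> makes every term
  vanish.\<close>

lemma lambda_max_up_eq_iff:
  assumes K: "simplicial_complex V K" and ne: "faces K i \<noteq> {}"
  shows "lambda_max_up K \<sigma> i = real i + 2 \<longleftrightarrow>
    (\<exists>f c. (\<exists>F\<in>faces K i. f F \<noteq> 0) \<and> (\<forall>F\<in>faces K i. facet K F \<longrightarrow> f F = 0) \<and>
      (\<forall>F\<in>faces K i. \<forall>G\<in>faces K (i + 1). F \<subset> G \<longrightarrow> real_of_int (incidence_sgn \<sigma> F G) * f F = c G))"
    (is "?L \<longleftrightarrow> ?R")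
proof -
  let ?S = "faces K i" and ?T = "faces K (i + 1)"
  let ?s = "\<lambda>F G. of_int (incidence_sgn \<sigma> F G) :: real"
  let ?Q = "\<lambda>f. face_inner K (i + 1) (coboundary K \<sigma> i f) (coboundary K \<sigma> i f)"
  let ?A = "\<lambda>f. \<Sum>F\<in>{F \<in> ?S. facet K F}. weight K F * (f F)\<^sup>2"
  let ?D = "\<lambda>f G. \<Sum>F\<in>{F \<in> ?S. F \<subset> G}. (?s F G * f F - coboundary K \<sigma> i f G / real (i + 2))\<^sup>2"
  let ?B = "\<lambda>f. \<Sum>G\<in>?T. weight K G * ?D f G"
  note E = energy_identity[OF K, where i = i and \<sigma> = \<sigma>]
  have fin: "finite (faces K j)" for j by (rule finite_faces[OF K])
  have D0: "?D f G \<ge> 0" for f G by (intro sum_nonneg) simp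
  have A0: "weight K F * (f F)\<^sup>2 \<ge> 0" if "F \<in> ?S" for f F
    using weight_faces_pos[OF K that] by simp
  have B0: "weight K G * ?D f G \<ge> 0" if "G \<in> ?T" for f G
    using weight_faces_pos[OF K that] D0[of G f] by simp
  have A: "?A f \<ge> 0" for f by (intro sum_nonneg) (use A0 in blast)
  have B: "?B f \<ge> 0" for f by (intro sum_nonneg B0)
  show ?thesis
  proof
    assume L: ?L
    obtain f where f: "\<exists>F\<in>?S. f F \<noteq> 0" "?Q f = real (i + 2) * face_inner K i f f"
      using lambda_max_up_max_rayleigh(1)[OF K ne, of \<sigma>] unfolding L by (auto simp: add.commute)
    have "real (i + 2) * (?A f + ?B f) = 0" using E[of f] f(2) by linarith
    then have AB: "?A f + ?B f = 0" by (simp only: mult_eq_0_iff of_nat_eq_0_iff) simp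
    have "?A f = 0" using A[of f] B[of f] AB by linarith
    then have facet: "\<forall>F\<in>?S. facet K F \<longrightarrow> f F = 0"
      using A0 weight_faces_pos[OF K]
      by (subst (asm) sum_nonneg_eq_0_iff) (force simp: fin)+
    have "?B f = 0" using A[of f] B[of f] AB by linarith
    then have "\<forall>G\<in>?T. weight K G * ?D f G = 0"
      by (subst (asm) sum_nonneg_eq_0_iff[OF fin B0]) auto
    then have "\<forall>G\<in>?T. ?D f G = 0" using weight_faces_pos[OF K] by fastforce
    \<comment> \<open>Zero variance makes the signed values equal to their mean, which serves as
      \<open>c\<close>.\<close>
    then have "\<forall>G\<in>?T. \<forall>F\<in>?S. F \<subset> G \<longrightarrow> ?s F G * f F = coboundary K \<sigma> i f G / real (i + 2)"
      by (subst (asm) sum_nonneg_eq_0_iff) (auto simp: fin)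
    with f(1) facet show ?R
      by - (rule exI[where x = f], rule exI[where x = "\<lambda>G. coboundary K \<sigma> i f G / real (i + 2)"], simp)
  next
    assume ?R
    then obtain f c where f: "\<exists>F\<in>?S. f F \<noteq> 0"
      and facet: "\<And>F. F \<in> ?S \<Longrightarrow> facet K F \<Longrightarrow> f F = 0"
      and c: "\<And>F G. F \<in> ?S \<Longrightarrow> G \<in> ?T \<Longrightarrow> F \<subset> G \<Longrightarrow> ?s F G * f F = c G"
      by metis
    \<comment> \<open>There are exactly \<open>i + 2\<close> equal summands, so the mean is again
      \<open>c G\<close>.\<close>
    have "coboundary K \<sigma> i f G / real (i + 2) = c G" if G: "G \<in> ?T" for G
    proof -
      have "coboundary K \<sigma> i f G = (\<Sum>F\<in>{F \<in> ?S. F \<subset> G}. ?s F G * f F)"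
        unfolding coboundary_def
        by (rule sum.mono_neutral_right) (auto simp: fin incidence_sgn_def)
      also have "\<dots> = (\<Sum>F\<in>{F \<in> ?S. F \<subset> G}. c G)" by (rule sum.cong) (simp_all add: c[OF _ G])
      finally show ?thesis using card_subfaces[OF K G] by simp
    qed
    then have "?D f G = 0" if "G \<in> ?T" for G using that by (intro sum.neutral) (simp add: c)
    then have "?B f = 0" by (intro sum.neutral) auto
    moreover have "?A f = 0" using facet by (intro sum.neutral) auto
    ultimately have "?Q f = real (i + 2) * face_inner K i f f" using E[of f] by simp
    then have "real (i + 2) * face_inner K i f f \<le> lambda_max_up K \<sigma> i * face_inner K i f f"
      using lambda_max_up_max_rayleigh(2)[OF K ne, of \<sigma> f] by simp
    moreover have "face_inner K i f f > 0" using f face_inner_self_pos[OF K] by blast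
    ultimately have ge: "real (i + 2) \<le> lambda_max_up K \<sigma> i" by simp
    \<comment> \<open>The upper bound needs a maximiser of its own, since \<open>f\<close> only
      bounds the maximum from below.\<close>
    obtain g where g: "\<exists>F\<in>?S. g F \<noteq> 0" "?Q g = lambda_max_up K \<sigma> i * face_inner K i g g"
      using lambda_max_up_max_rayleigh(1)[OF K ne, of \<sigma>] by blast
    have "real (i + 2) * (?A g + ?B g) \<ge> 0"
      using A[of g] B[of g] by (intro mult_nonneg_nonneg add_nonneg_nonneg) auto
    then have "?Q g \<le> real (i + 2) * face_inner K i g g" using E[of g] by linarith
    moreover have "face_inner K i g g > 0" using g face_inner_self_pos[OF K] by blast
    ultimately have "lambda_max_up K \<sigma> i \<le> real (i + 2)" using g(2) by simp
    with ge show ?L by simp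
  qed
qed

section \<open>Balanced signed graphs\<close>

fun walk_sign :: "'v signed_graph \<Rightarrow> 'v list \<Rightarrow> int" where
  "walk_sign G (x # y # xs) = edge_sign G {x, y} * walk_sign G (y # xs)"
| "walk_sign G xs = 1"

abbreviation graph_walk :: "'v signed_graph \<Rightarrow> 'v list \<Rightarrow> bool" where
  "graph_walk G \<equiv> successively (\<lambda>x y. {x, y} \<in> edges G)"

text \<open>The splitting vertex \<open>y\<close> is kept in both halves, so that no edge is
  lost.\<close>

lemma successively_append_Cons:
  "successively P (xs @ y # ys) \<longleftrightarrow> successively P (xs @ [y]) \<and> successively P (y # ys)"
  by (auto simp: successively_append_iff)

lemma walk_sign_append:
  "walk_sign G (xs @ y # ys) = walk_sign G (xs @ [y]) * walk_sign G (y # ys)"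
  by (induction G xs rule: walk_sign.induct) auto

lemma walk_sign_rev: "walk_sign G (rev xs) = walk_sign G xs"
proof (induction G xs rule: walk_sign.induct)
  case (1 G x y xs)
  then show ?case using walk_sign_append[of G "rev xs" y "[x]"] by (simp add: insert_commute)
qed auto

text \<open>Matches the recursive sign with the indexed product in \<open>balanced\<close>.\<close>

lemma walk_sign_conv_prod:
  "xs \<noteq> [] \<Longrightarrow> walk_sign G xs = (\<Prod>j<length xs - 1. edge_sign G {xs ! j, xs ! Suc j})"
proof (induction G xs rule: walk_sign.induct)
  case (1 G x y xs)
  then show ?case by (simp add: prod.lessThan_Suc_shift del: prod.lessThan_Suc)
qed auto

lemma walk_sign_square:
  assumes "\<And>e. e \<in> edges G \<Longrightarrow> edge_sign G e * edge_sign G e = 1"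
  shows "graph_walk G xs \<Longrightarrow> walk_sign G xs * walk_sign G xs = 1"
proof (induction xs rule: induct_list012)
  case (3 x y xs)
  have "walk_sign G (x # y # xs) * walk_sign G (x # y # xs) =
      (edge_sign G {x, y} * edge_sign G {x, y}) * (walk_sign G (y # xs) * walk_sign G (y # xs))"
    by simp
  also have "\<dots> = 1" using 3 assms by simp
  finally show ?case .
qed auto

text \<open>A repeated vertex cuts a closed walk into two shorter closed walks whose signs multiply.
  Without repetitions the walk is a cycle or runs along one edge and back; a loop is
  impossible.\<close>

lemma balanced_closed_walk:
  assumes sq: "\<And>e. e \<in> edges G \<Longrightarrow> edge_sign G e * edge_sign G e = 1"
    and edges: "\<And>x y. {x, y} \<in> edges G \<Longrightarrow> x \<in> vertices G \<and> y \<in> vertices G \<and> x \<noteq> y"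
    and bal: "balanced G"
  shows "graph_walk G (x # xs @ [x]) \<Longrightarrow> walk_sign G (x # xs @ [x]) = 1"
proof (induction "length xs" arbitrary: x xs rule: less_induct)
  case less
  note walk = less.prems
  show ?case
  proof (cases "distinct (x # xs)")
    case False
    \<comment> \<open>\<open>y\<close> is the repeated vertex: \<open>bs\<close> belongs to the part
      cut out, and \<open>as\<close>, \<open>cs\<close> form the remaining walk.\<close>
    then obtain as bs cs y where dec: "x # xs = as @ [y] @ bs @ [y] @ cs"
      using not_distinct_decomp by blast
    then have full: "x # xs @ [x] = as @ y # bs @ y # cs @ [x]" by simp
    have walks: "graph_walk G (as @ [y])" "graph_walk G (y # bs @ [y])" "graph_walk G (y # cs @ [x])"
      using walk successively_append_Cons[of _ as y "bs @ y # cs @ [x]"]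
        successively_append_Cons[of _ "y # bs" y "cs @ [x]"]
      unfolding full by simp_all
    have "length bs < length xs" using arg_cong[OF dec, of length] by simp
    then have inner: "walk_sign G (y # bs @ [y]) = 1" using walks(2) less.hyps by blast
    have outer: "walk_sign G (as @ y # cs @ [x]) = 1"
    proof (cases as)
      \<comment> \<open>Here the starting vertex itself is the repeated one.\<close>
      case Nil
      then have xy: "y = x" using dec by simp
      have "length cs < length xs" using arg_cong[OF dec, of length] Nil by simp
      then show ?thesis using less.hyps[of cs x] walks(3) Nil xy by simp
    next
      case (Cons a as')
      then have a: "a = x" using dec by simp
      have "graph_walk G (as @ y # cs @ [x])"
        using walks successively_append_Cons[of _ as y "cs @ [x]"] by blast
      moreover have "length (as' @ y # cs) < length xs"
        using arg_cong[OF dec, of length] Cons by simp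
      ultimately show ?thesis using less.hyps[of "as' @ y # cs" x] Cons a by simp
    qed
    have "walk_sign G (x # xs @ [x]) =
        walk_sign G (as @ [y]) * (walk_sign G (y # bs @ [y]) * walk_sign G (y # cs @ [x]))"
      unfolding full using walk_sign_append[of G as y "bs @ y # cs @ [x]"]
        walk_sign_append[of G "y # bs" y "cs @ [x]"] by simp
    also have "\<dots> = walk_sign G (as @ y # cs @ [x])"
      using inner walk_sign_append[of G as y "cs @ [x]"] by simp
    finally show ?thesis using outer by simp
  next
    case True
    show ?thesis
    proof (cases "length xs \<le> 1")
      case True
      \<comment> \<open>\<open>graph_cycle\<close> asks for three vertices, so the shortest closed
        walks are treated apart: \<open>x, x\<close> would be a loop, and \<open>x, y, x\<close>
        squares one sign.\<close>
      then consider "xs = []" | y where "xs = [y]" by (cases xs) auto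
      then show ?thesis
      proof cases
        case 1
        then show ?thesis using walk edges[of x x] by simp
      next
        case 2
        then have "{x, y} \<in> edges G" using walk by simp
        then show ?thesis using 2 sq[of "{x, y}"] by (simp add: insert_commute)
      qed
    next
      case False
      let ?vs = "x # xs"
      \<comment> \<open>The walk repeats \<open>x\<close> at its end, whereas a cycle closes up by
        indices modulo its length.\<close>
      have nth: "(x # xs @ [x]) ! j = ?vs ! j \<and> (x # xs @ [x]) ! Suc j = ?vs ! (Suc j mod length ?vs)"
        if "j < length ?vs" for j
        using that by (cases "Suc j = length ?vs") (auto simp: nth_append nth_Cons')
      have edge: "{?vs ! j, ?vs ! (Suc j mod length ?vs)} \<in> edges G" if "j < length ?vs" for j
        using successively_nth[OF walk, of j] nth[OF that] that by simp
      have "?vs ! j \<in> vertices G" if "j < length ?vs" for j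
        using edges edge[OF that] by blast
      then have "set ?vs \<subseteq> vertices G" by (auto simp: in_set_conv_nth simp del: set_simps)
      with True False edge have "graph_cycle G ?vs"
        unfolding graph_cycle_def by auto
      then have "(\<Prod>j<length ?vs. edge_sign G {?vs ! j, ?vs ! (Suc j mod length ?vs)}) > 0"
        using bal unfolding balanced_def by blast
      also have "(\<Prod>j<length ?vs. edge_sign G {?vs ! j, ?vs ! (Suc j mod length ?vs)}) =
          (\<Prod>j<length ?vs. edge_sign G {(x # xs @ [x]) ! j, (x # xs @ [x]) ! Suc j})"
        by (rule prod.cong) (use nth in auto)
      also have "\<dots> = walk_sign G (x # xs @ [x])" by (simp add: walk_sign_conv_prod)
      finally have "walk_sign G (x # xs @ [x]) > 0" .
      moreover have "walk_sign G (x # xs @ [x]) * walk_sign G (x # xs @ [x]) = 1"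
        using sq walk by (rule walk_sign_square)
      ultimately show ?thesis using pos_zmult_eq_1_iff by blast
    qed
  qed
qed

text \<open>Harary's criterion: switching along walks from a root makes every edge of a balanced graph
  positive.\<close>

lemma balanced_potential:
  assumes sq: "\<And>e. e \<in> edges G \<Longrightarrow> edge_sign G e * edge_sign G e = 1"
    and edges: "\<And>x y. {x, y} \<in> edges G \<Longrightarrow> x \<in> vertices G \<and> y \<in> vertices G \<and> x \<noteq> y"
    and bal: "balanced G"
    and conn: "\<And>x. x \<in> X \<Longrightarrow> \<exists>xs. graph_walk G (r # xs @ [x])"
  obtains p :: "'v \<Rightarrow> int" where "\<And>x. x \<in> X \<Longrightarrow> p x * p x = 1"
    "\<And>x y. x \<in> X \<Longrightarrow> y \<in> X \<Longrightarrow> {x, y} \<in> edges G \<Longrightarrow> edge_sign G {x, y} = p x * p y"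
proof -
  obtain w where w: "\<And>x. x \<in> X \<Longrightarrow> graph_walk G (r # w x @ [x])" using conn by metis
  \<comment> \<open>The list has two separate ends \<open>r\<close> and \<open>x\<close>, so even
    the root needs a walk with an edge.\<close>
  define p where "p = (\<lambda>x. walk_sign G (r # w x @ [x]))"
  have p: "p x * p x = 1" if "x \<in> X" for x
    unfolding p_def using sq w[OF that] by (rule walk_sign_square)
  show thesis
  proof (rule that[of p])
    show "p x * p x = 1" if "x \<in> X" for x by (rule p[OF that])
    fix x y assume x: "x \<in> X" and y: "y \<in> X" and xy: "{x, y} \<in> edges G"
    let ?ys = "rev (r # w y)"
    have rw: "graph_walk G (y # ?ys)"
      using w[OF y] successively_rev[of "\<lambda>x y. {x, y} \<in> edges G" "r # w y @ [y]"]
      by (simp add: insert_commute)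
    \<comment> \<open>Going out to \<open>x\<close>, across the edge to \<open>y\<close> and back
      along the reversed walk closes up at \<open>r\<close>, so balance makes the total sign
      1.\<close>
    have "graph_walk G ((r # w x) @ x # y # ?ys)"
      unfolding successively_append_Cons[of _ "r # w x" x "y # ?ys"] using w[OF x] rw xy by simp
    then have closed: "graph_walk G (r # (w x @ x # y # rev (w y)) @ [r])" by simp
    have "walk_sign G (r # (w x @ x # y # rev (w y)) @ [r]) = 1"
      by (rule balanced_closed_walk[OF _ _ bal closed]) (use sq edges in blast)+
    moreover have "walk_sign G (r # (w x @ x # y # rev (w y)) @ [r]) =
        p x * (edge_sign G {x, y} * walk_sign G (y # ?ys))"
      using walk_sign_append[of G "r # w x" x "y # ?ys"] by (simp add: p_def)
    moreover have "walk_sign G (y # ?ys) = p y"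
      using walk_sign_rev[of G "r # w y @ [y]"] by (simp add: p_def)
    ultimately have eq: "p x * (edge_sign G {x, y} * p y) = 1" by simp
    have "edge_sign G {x, y} = (p x * p x) * (p y * p y) * edge_sign G {x, y}"
      using p x y by simp
    also have "\<dots> = p x * p y * (p x * (edge_sign G {x, y} * p y))" by (simp only: mult_ac)
    finally show "edge_sign G {x, y} = p x * p y" using eq by simp
  qed
qed

text \<open>Around a cycle each vertex value occurs twice, so the product of all
  \<open>p x * p y\<close> is a positive square and drops out. The values of \<open>p\<close> are
  reals, not only signs, because an extremal function will supply them.\<close>

lemma potential_balanced:
  fixes p :: "'v \<Rightarrow> real"
  assumes "\<And>x y. {x, y} \<in> edges G \<Longrightarrow> of_int (edge_sign G {x, y}) * (p x * p y) > 0"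
  shows "balanced G"
  unfolding balanced_def
proof (intro allI impI)
  fix vs assume cyc: "graph_cycle G vs"
  let ?n = "length vs"
  have n: "?n > 0" and edge: "\<And>j. j < ?n \<Longrightarrow> {vs ! j, vs ! (Suc j mod ?n)} \<in> edges G"
    using cyc unfolding graph_cycle_def by auto
  let ?s = "\<lambda>j. of_int (edge_sign G {vs ! j, vs ! (Suc j mod ?n)}) :: real"
  \<comment> \<open>The successor indices are a cyclic shift of the indices.\<close>
  have shift: "(\<Prod>j<?n. p (vs ! (Suc j mod ?n))) = (\<Prod>j<?n. p (vs ! j))"
  proof -
    obtain m where m: "?n = Suc m" using n by (cases ?n) auto
    have "(\<Prod>j<m. p (vs ! (Suc j mod Suc m))) = (\<Prod>j<m. p (vs ! Suc j))"
      by (rule prod.cong) auto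
    then have "(\<Prod>j<?n. p (vs ! (Suc j mod ?n))) = p (vs ! 0) * (\<Prod>j<m. p (vs ! Suc j))"
      unfolding m by simp
    also have "\<dots> = (\<Prod>j<?n. p (vs ! j))" unfolding m by (simp only: prod.lessThan_Suc_shift o_def)
    finally show ?thesis .
  qed
  have "0 < (\<Prod>j<?n. ?s j * (p (vs ! j) * p (vs ! (Suc j mod ?n))))"
    by (rule prod_pos) (use assms edge in auto)
  also have "\<dots> = (\<Prod>j<?n. ?s j) * (\<Prod>j<?n. p (vs ! j))\<^sup>2"
    by (simp add: prod.distrib shift power2_eq_square)
  finally have "(\<Prod>j<?n. ?s j) > 0" by (simp add: zero_less_mult_iff)
  then have "(of_int (\<Prod>j<?n. edge_sign G {vs ! j, vs ! (Suc j mod ?n)}) :: real) > 0" by simp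
  then show "(\<Prod>j<?n. edge_sign G {vs ! j, vs ! (Suc j mod ?n)}) > 0" by linarith
qed

section \<open>Path components\<close>

lemma simplicial_complex_subset: "simplicial_complex V L \<Longrightarrow> F \<in> L \<Longrightarrow> G \<subseteq> F \<Longrightarrow> G \<in> L"
  unfolding simplicial_complex_def by blast

lemma face_path_connectedE:
  assumes "face_path_connected K i" "F \<in> faces K (i + 1)" "G \<in> faces K (i + 1)"
  obtains Fs where "face_path K i Fs" "hd Fs = F" "last Fs = G"
  using assms unfolding face_path_connected_def by metis

text \<open>The diagonal case \<open>j = l\<close> holds because \<open>G\<close> has one vertex too
  many for an \<open>i\<close>-face.\<close>

lemma face_path_single: "G \<in> faces K (i + 1) \<Longrightarrow> face_path K i [G]"
  by (auto simp: face_path_def faces_def)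

text \<open>The path condition also forbids adjacencies, but intersections of faces of
  \<open>L\<close> are already in \<open>L\<close>, so a larger complex turns none of them into a
  new \<open>i\<close>-face.\<close>

lemma face_path_mono:
  assumes L: "simplicial_complex V L" "L \<subseteq> M" and p: "face_path L i Fs"
  shows "face_path M i Fs"
proof -
  have "Fs ! j \<inter> Fs ! l \<in> L" if "j < length Fs" for j l
    using that p simplicial_complex_subset[OF L(1), of "Fs ! j" "Fs ! j \<inter> Fs ! l"]
    unfolding face_path_def faces_def by (auto dest!: nth_mem)
  then have "Fs ! j \<inter> Fs ! l \<in> faces L i \<longleftrightarrow> Fs ! j \<inter> Fs ! l \<in> faces M i" if "j < length Fs" for j l
    using that L(2) by (auto simp: faces_def)
  moreover have "set Fs \<subseteq> faces M (i + 1)" using p L(2) by (auto simp: face_path_def faces_def)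
  ultimately show ?thesis using p unfolding face_path_def by simp
qed

lemma face_path_rev:
  assumes "face_path K i Fs"
  shows "face_path K i (rev Fs)"
proof -
  let ?n = "length Fs"
  have p: "Fs ! j \<inter> Fs ! l \<in> faces K i \<longleftrightarrow> (l = j + 1 \<or> j = l + 1)" if "j < ?n" "l < ?n" for j l
    using assms that unfolding face_path_def by blast
  have "rev Fs ! j \<inter> rev Fs ! l \<in> faces K i \<longleftrightarrow> (l = j + 1 \<or> j = l + 1)"
    if "j < ?n" "l < ?n" for j l
    using p[of "?n - Suc j" "?n - Suc l"] that by (auto simp: rev_nth)
  then show ?thesis using assms unfolding face_path_def by simp
qed

text \<open>Shortcutting at the first face adjacent to the new end keeps the path induced.\<close>

lemma face_path_extend:
  assumes p: "face_path K i Fs" and G: "G \<in> faces K (i + 1)"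
    and adj: "last Fs \<inter> G \<in> faces K i"
  shows "\<exists>Gs. face_path K i Gs \<and> hd Gs = hd Fs \<and> last Gs = G"
proof -
  have ne: "Fs \<noteq> []" and sub: "set Fs \<subseteq> faces K (i + 1)"
    and path: "\<And>j l. j < length Fs \<Longrightarrow> l < length Fs \<Longrightarrow>
       Fs ! j \<inter> Fs ! l \<in> faces K i \<longleftrightarrow> (l = j + 1 \<or> j = l + 1)"
    using p unfolding face_path_def by blast+
  define k where "k = (LEAST k. Fs ! k \<inter> G \<in> faces K i)"
  have last: "Fs ! (length Fs - 1) \<inter> G \<in> faces K i" using adj ne by (simp add: last_conv_nth)
  have k: "Fs ! k \<inter> G \<in> faces K i" unfolding k_def by (rule LeastI[of _ "length Fs - 1"]) (rule last)
  have least: "Fs ! j \<inter> G \<notin> faces K i" if "j < k" for j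
    using that not_less_Least unfolding k_def by blast
  have "k \<le> length Fs - 1" unfolding k_def by (rule Least_le) (rule last)
  then have kl: "k < length Fs" using ne by (cases Fs) auto
  \<comment> \<open>Faces after the first neighbour of \<open>G\<close> are dropped, and those
    before it do not meet \<open>G\<close> in an \<open>i\<close>-face.\<close>
  let ?Gs = "take (Suc k) Fs @ [G]"
  have len: "length ?Gs = Suc (Suc k)" using kl by simp
  have nth: "?Gs ! j = (if j \<le> k then Fs ! j else G)" if "j < Suc (Suc k)" for j
    using that kl by (auto simp: nth_append)
  have GG: "G \<inter> G \<notin> faces K i" using G by (auto simp: faces_def)
  have "?Gs ! j \<inter> ?Gs ! l \<in> faces K i \<longleftrightarrow> (l = j + 1 \<or> j = l + 1)"
    if j: "j < Suc (Suc k)" and l: "l < Suc (Suc k)" for j l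
  proof -
    consider "j \<le> k" "l \<le> k" | "j \<le> k" "l = Suc k" | "j = Suc k" "l \<le> k" | "j = Suc k" "l = Suc k"
      using j l by linarith
    then show ?thesis
    proof cases
      case 1 then show ?thesis using path[of j l] kl nth j l by simp
    next
      case 2 then show ?thesis using k least[of j] nth[OF j] nth[OF l] by (cases "j = k") auto
    next
      case 3 then show ?thesis
        using k least[of l] nth[OF j] nth[OF l] by (cases "l = k") (auto simp: Int_commute)
    next
      case 4 then show ?thesis using GG nth[OF j] nth[OF l] by simp
    qed
  qed
  moreover have "set ?Gs \<subseteq> faces K (i + 1)" using sub G set_take_subset[of "Suc k" Fs] by auto
  ultimately have "face_path K i ?Gs" unfolding face_path_def len by blast
  moreover have "hd ?Gs = hd Fs" using ne by (cases Fs) auto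
  ultimately show ?thesis by (metis last_snoc)
qed

lemma simplicial_complex_Pow:
  assumes "simplicial_complex V K" "G \<in> K" shows "simplicial_complex V (Pow G)" "Pow G \<subseteq> K"
  using assms unfolding simplicial_complex_def by blast+

lemma simplicial_complex_Un:
  "simplicial_complex V L \<Longrightarrow> simplicial_complex V M \<Longrightarrow> simplicial_complex V (L \<union> M)"
  unfolding simplicial_complex_def by (simp add: ball_Un)

lemma faces_Un: "faces (L \<union> M) i = faces L i \<union> faces M i"
  by (auto simp: faces_def)

lemma faces_Pow:
  assumes K: "simplicial_complex V K" and G: "G \<in> faces K i"
  shows "faces (Pow G) i = {G}"
  using G finite_face[OF K, of G] card_subset_eq[of G] by (auto simp: faces_def)

lemma faces_mono: "L \<subseteq> K \<Longrightarrow> faces L i \<subseteq> faces K i"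
  by (auto simp: faces_def)

text \<open>\<open>Pow G\<close> is path connected, with \<open>G\<close> as its only
  \<open>(i+1)\<close>-face, and \<open>K\<close> has finitely many subcomplexes; a maximal path
  connected one above \<open>Pow G\<close> is the component.\<close>

lemma ex_face_path_component:
  assumes K: "simplicial_complex V K" and G: "G \<in> faces K (i + 1)"
  shows "\<exists>L. face_path_component V K i L \<and> G \<in> faces L (i + 1)"
proof -
  let ?A = "{M. simplicial_complex V M \<and> M \<subseteq> K \<and> face_path_connected M i}"
  have "finite ?A"
    by (rule finite_subset[of _ "Pow K"]) (auto simp: finite_simplicial_complex[OF K])
  moreover have GK: "G \<in> K" using G by (simp add: faces_def)
  have "G \<in> faces (Pow G) (i + 1)" using faces_Pow[OF K G] by simp
  then have "face_path (Pow G) i [G]" by (rule face_path_single)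
  then have "face_path_connected (Pow G) i"
    unfolding face_path_connected_def faces_Pow[OF K G] by force
  then have "Pow G \<in> ?A" using simplicial_complex_Pow[OF K GK] by blast
  ultimately obtain L where L: "L \<in> ?A" "Pow G \<subseteq> L" "\<forall>M\<in>?A. L \<subseteq> M \<longrightarrow> L = M"
    using finite_has_maximal2[of ?A "Pow G"] by blast
  then have "face_path_component V K i L" unfolding face_path_component_def by blast
  moreover have "G \<in> faces L (i + 1)" using L(2) G by (auto simp: faces_def)
  ultimately show ?thesis by blast
qed

text \<open>A complex without \<open>(i+1)\<close>-faces is vacuously path connected, so this rests
  on maximality: one face \<open>G\<close> with all its subsets could still be added.\<close>

lemma component_nonempty:
  assumes K: "simplicial_complex V K" and ne: "faces K (i + 1) \<noteq> {}"
    and L: "face_path_component V K i L"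
  shows "faces L (i + 1) \<noteq> {}"
proof
  assume empty: "faces L (i + 1) = {}"
  obtain G where G: "G \<in> faces K (i + 1)" using ne by blast
  then have GK: "G \<in> K" by (simp add: faces_def)
  let ?M = "L \<union> Pow G"
  have fM: "faces ?M (i + 1) = {G}" unfolding faces_Un empty faces_Pow[OF K G] by simp
  then have "face_path ?M i [G]" by (intro face_path_single) simp
  then have "face_path_connected ?M i" unfolding face_path_connected_def fM by force
  then have "?M = L"
    using L simplicial_complex_Pow[OF K GK] simplicial_complex_Un
    unfolding face_path_component_def by blast
  with fM empty show False by simp
qed

text \<open>By maximality it suffices that \<open>L \<union> Pow G\<close> is path connected: paths
  to \<open>G'\<close> extend to \<open>G\<close>, and reversal gives the paths from
  \<open>G\<close>.\<close>

lemma component_closed: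
  assumes K: "simplicial_complex V K" and L: "face_path_component V K i L"
    and G': "G' \<in> faces L (i + 1)" and G: "G \<in> faces K (i + 1)" and F: "G' \<inter> G \<in> faces K i"
  shows "G \<in> faces L (i + 1)"
proof -
  have GK: "G \<in> K" using G by (simp add: faces_def)
  have sL: "simplicial_complex V L" "L \<subseteq> K" and cL: "face_path_connected L i"
    using L unfolding face_path_component_def by blast+
  let ?M = "L \<union> Pow G"
  have sM: "simplicial_complex V ?M" using simplicial_complex_Pow[OF K GK] simplicial_complex_Un sL by blast
  have fM: "faces ?M (i + 1) = insert G (faces L (i + 1))"
    unfolding faces_Un faces_Pow[OF K G] by simp
  have GM: "G \<in> faces ?M (i + 1)" using fM by simp
  have F': "G' \<inter> G \<in> faces ?M i" using F by (auto simp: faces_def)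
  have toG: "\<exists>Gs. face_path ?M i Gs \<and> hd Gs = H \<and> last Gs = G" if H: "H \<in> faces L (i + 1)" for H
  proof -
    obtain Fs where Fs: "face_path L i Fs" "hd Fs = H" "last Fs = G'"
      by (rule face_path_connectedE[OF cL H G'])
    have "face_path ?M i Fs" by (rule face_path_mono[OF sL(1) Un_upper1 Fs(1)])
    moreover have "last Fs \<inter> G \<in> faces ?M i" using F' Fs(3) by simp
    ultimately show ?thesis using face_path_extend[OF _ GM] Fs(2) by metis
  qed
  have fromG: "\<exists>Gs. face_path ?M i Gs \<and> hd Gs = G \<and> last Gs = H" if H: "H \<in> faces L (i + 1)" for H
  proof -
    obtain Gs where Gs: "face_path ?M i Gs" "hd Gs = H" "last Gs = G" using toG[OF H] by blast
    then have "Gs \<noteq> []" by (simp add: face_path_def)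
    then show ?thesis using face_path_rev[OF Gs(1)] Gs(2,3) by (metis hd_rev last_rev)
  qed
  have "\<exists>Gs. face_path ?M i Gs \<and> hd Gs = H1 \<and> last Gs = H2"
    if H12: "H1 \<in> faces ?M (i + 1)" "H2 \<in> faces ?M (i + 1)" for H1 H2
  proof -
    consider "H1 = G" "H2 = G" | "H1 = G" "H2 \<in> faces L (i + 1)" | "H1 \<in> faces L (i + 1)" "H2 = G"
      | "H1 \<in> faces L (i + 1)" "H2 \<in> faces L (i + 1)" using H12 unfolding fM by blast
    then show ?thesis
    proof cases
      case 1 then show ?thesis using face_path_single[OF GM] by force
    next
      case 2 then show ?thesis using fromG by blast
    next
      case 3 then show ?thesis using toG by blast
    next
      case 4
      then obtain Fs where Fs: "face_path L i Fs" "hd Fs = H1" "last Fs = H2"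
        using face_path_connectedE[OF cL] by metis
      then show ?thesis using face_path_mono[OF sL(1) Un_upper1 Fs(1)] by blast
    qed
  qed
  then have "face_path_connected ?M i" unfolding face_path_connected_def by blast
  then have "?M = L"
    using L sM simplicial_complex_Pow[OF K GK] sL unfolding face_path_component_def by blast
  then show ?thesis using GM by simp
qed

text \<open>Consecutive faces are adjacent, so an invariant spreads from the head; this carries
  nonvanishing and reachability through a component.\<close>

lemma face_path_induct:
  assumes "face_path K i Fs" and "P (hd Fs)"
    and step: "\<And>G H. G \<in> faces K (i + 1) \<Longrightarrow> H \<in> faces K (i + 1) \<Longrightarrow> G \<inter> H \<in> faces K i \<Longrightarrow> P G \<Longrightarrow> P H"
  shows "P (last Fs)"
proof -
  have ne: "Fs \<noteq> []" and sub: "set Fs \<subseteq> faces K (i + 1)"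
    and path: "\<And>j. Suc j < length Fs \<Longrightarrow> Fs ! j \<inter> Fs ! Suc j \<in> faces K i"
    using assms(1) unfolding face_path_def by auto
  have "P (Fs ! j)" if "j < length Fs" for j
    using that
  proof (induction j)
    case 0 then show ?case using assms(2) ne by (simp add: hd_conv_nth)
  next
    case (Suc j)
    then show ?case using step[of "Fs ! j" "Fs ! Suc j"] path sub nth_mem[of _ Fs] by (meson Suc_lessD subsetD)
  qed
  then show ?thesis using ne by (simp add: last_conv_nth)
qed

text \<open>Distinct sets of size \<open>i + 2\<close> share at most \<open>i + 1\<close> elements,
  and \<open>F\<close> already accounts for that many.\<close>

lemma two_faces_Int:
  assumes K: "simplicial_complex V K" and "G \<in> faces K (i + 1)" "H \<in> faces K (i + 1)"
    and "F \<in> faces K i" "F \<subset> G" "F \<subset> H" "G \<noteq> H"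
  shows "G \<inter> H = F"
proof -
  have fin: "finite G" "finite H" and c: "card G = i + 2" "card H = i + 2" "card F = i + 1"
    using assms finite_face[OF K] by (auto simp: faces_def)
  have "G \<inter> H \<noteq> G" using fin c assms(7) card_subset_eq[of H G] by auto
  then have "card (G \<inter> H) < card G" using fin by (intro psubset_card_mono) auto
  then show ?thesis using fin c assms(5,6) card_seteq[of "G \<inter> H" F] by auto
qed

lemma Int_face_psubset:
  assumes "G \<in> faces K (i + 1)" "H \<in> faces K (i + 1)" "G \<inter> H \<in> faces K i"
  shows "G \<inter> H \<subset> G" "G \<inter> H \<subset> H"
  using assms by (auto simp: faces_def)

text \<open>Two distinct cofaces of \<open>F\<close> meet exactly in \<open>F\<close>, hence are
  adjacent.\<close>

lemma component_neighbour:
  assumes K: "simplicial_complex V K" and L: "face_path_component V K i L"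
    and "G' \<in> faces L (i + 1)" "F \<in> faces K i" "F \<subset> G'" "F \<subset> G" "G \<in> faces K (i + 1)"
  shows "G \<in> faces L (i + 1)"
proof (cases "G' = G")
  case False
  have "G' \<in> faces K (i + 1)" using assms(3) L faces_mono unfolding face_path_component_def by blast
  then have "G' \<inter> G = F" using two_faces_Int[OF K] assms False by blast
  then show ?thesis using component_closed[OF K L assms(3,7)] assms(4) by simp
qed (use assms(3) in simp)

lemma dimension_faces:
  assumes K: "simplicial_complex V K" and dim: "dimension K > int i"
  shows "faces K (i + 1) \<noteq> {}" "faces K i \<noteq> {}"
proof -
  have "\<exists>x\<in>insert (-1) ((\<lambda>F. int (card F) - 1) ` K). int i < x"
    using dim finite_simplicial_complex[OF K] unfolding dimension_def by (subst (asm) Max_gr_iff) auto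
  \<comment> \<open>\<open>-1\<close> cannot exceed \<open>int i\<close>, so the witness is a
    genuine face; dimension above \<open>i\<close> means at least \<open>i + 2\<close>
    vertices.\<close>
  then obtain F where F: "F \<in> K" "i + 2 \<le> card F" by force
  have "\<exists>G. G \<in> K \<and> card G = n" if "n \<le> card F" for n
    using obtain_subset_with_card_n[OF that] simplicial_complex_subset[OF K F(1)] by metis
  from this[of "i + 2"] this[of "i + 1"] show "faces K (i + 1) \<noteq> {}" "faces K i \<noteq> {}"
    using F by (auto simp: faces_def)
qed

section \<open>The signed incidence graph of a subcomplex\<close>

lemma edges_incidence:
  "e \<in> edges (signed_incidence_graph L \<sigma> i) \<longleftrightarrow>
    (\<exists>F G. e = {F, G} \<and> F \<in> faces L i \<and> G \<in> faces L (i + 1) \<and> F \<subset> G)"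
  by (auto simp: signed_incidence_graph_def)

lemma edge_sign_incidence:
  "F \<subset> G \<Longrightarrow> edge_sign (signed_incidence_graph L \<sigma> i) {F, G} = incidence_sgn \<sigma> F G"
  by (simp add: signed_incidence_graph_def inf.absorb1 sup.absorb2 psubset_imp_subset)

lemma edge_incidence_cases:
  assumes "{x, y} \<in> edges (signed_incidence_graph L \<sigma> i)"
  obtains "x \<in> faces L i" "y \<in> faces L (i + 1)" "x \<subset> y"
  | "y \<in> faces L i" "x \<in> faces L (i + 1)" "y \<subset> x"
  using assms unfolding edges_incidence by (auto simp: doubleton_eq_iff)

theorem theorem3p1:
  fixes V :: "'a set" and K :: "'a set set"
    and \<sigma> :: "'a set \<Rightarrow> 'a list set" and i :: nat
  assumes "simplicial_complex V K"
    and "dimension K > int i"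
    and "orientation K \<sigma>"
  shows "lambda_max_up K \<sigma> i = real i + 2 \<longleftrightarrow>
         (\<exists>K'. face_path_component V K i K' \<and> balanced (signed_incidence_graph K' \<sigma> i))"
proof -
  note K = assms(1)
  note ne = dimension_faces[OF assms(1,2)]
  let ?s = "\<lambda>F G. of_int (incidence_sgn \<sigma> F G) :: real"
  have s0: "?s F G \<noteq> 0" if "F \<subset> G" for F G
    using incidence_sgn_power2[OF that, of \<sigma>] by (metis power_zero_numeral zero_neq_one)
  show ?thesis
    unfolding lambda_max_up_eq_iff[OF K ne(2)]
  proof

    \<comment> \<open>From an extremal function to a balanced component\<close>
    assume "\<exists>f c. (\<exists>F\<in>faces K i. f F \<noteq> 0) \<and> (\<forall>F\<in>faces K i. facet K F \<longrightarrow> f F = 0) \<and>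
      (\<forall>F\<in>faces K i. \<forall>G\<in>faces K (i + 1). F \<subset> G \<longrightarrow> ?s F G * f F = c G)"
    \<comment> \<open>\<open>f\<close> vanishes on facets, so a face with nonzero value has a coface
      to start from.\<close>
    then obtain f c F0 where F0: "F0 \<in> faces K i" "f F0 \<noteq> 0" "\<not> facet K F0"
      and c: "\<And>F G. F \<in> faces K i \<Longrightarrow> G \<in> faces K (i + 1) \<Longrightarrow> F \<subset> G \<Longrightarrow> ?s F G * f F = c G"
      by metis
    obtain G0 where G0: "G0 \<in> faces K (i + 1)" "F0 \<subset> G0"
      using ex_coface[OF K _ F0(3)] F0(1) by (auto simp: faces_def)
    have cG0: "c G0 \<noteq> 0" using c[OF F0(1) G0] F0(2) s0[OF G0(2)] by auto
    obtain L where L: "face_path_component V K i L" "G0 \<in> faces L (i + 1)"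
      using ex_face_path_component[OF K G0(1)] by blast
    have LK: "L \<subseteq> K" and conn: "face_path_connected L i"
      using L(1) unfolding face_path_component_def by blast+
    have sub: "F \<in> faces K j" if "F \<in> faces L j" for F j using that faces_mono[OF LK] by blast
    \<comment> \<open>Adjacent faces \<open>G\<close> and \<open>H\<close> share
      \<open>G \<inter> H\<close>, and both \<open>c G\<close> and \<open>c H\<close> equal
      \<open>f (G \<inter> H)\<close> up to sign.\<close>
    have cG: "c G \<noteq> 0" if G: "G \<in> faces L (i + 1)" for G
    proof -
      obtain Fs where Fs: "face_path L i Fs" "hd Fs = G0" "last Fs = G"
        by (rule face_path_connectedE[OF conn L(2) G])
      have "c (last Fs) \<noteq> 0"
      proof (rule face_path_induct[OF Fs(1)])
        show "c (hd Fs) \<noteq> 0" using Fs(2) cG0 by simp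
        fix G H assume GH: "G \<in> faces L (i + 1)" "H \<in> faces L (i + 1)" "G \<inter> H \<in> faces L i" "c G \<noteq> 0"
        note ps = Int_face_psubset[OF GH(1-3)]
        have "f (G \<inter> H) \<noteq> 0" using c[of "G \<inter> H" G] sub ps GH by auto
        then show "c H \<noteq> 0" using c[of "G \<inter> H" H] sub ps GH s0[OF ps(2)] by auto
      qed
      then show ?thesis using Fs(3) by simp
    qed
    \<comment> \<open>The two vertex classes differ in cardinality, so \<open>f\<close> and
      \<open>c\<close> merge into one potential on the graph.\<close>
    define p where "p = (\<lambda>X. if X \<in> faces K i then f X else c X)"
    have key: "of_int (incidence_sgn \<sigma> F G) * (p F * p G) > 0"
      if F: "F \<in> faces L i" and G: "G \<in> faces L (i + 1)" and FG: "F \<subset> G" for F G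
    proof -
      have "G \<notin> faces K i" using G by (auto simp: faces_def)
      then have "?s F G * (p F * p G) = c G * c G"
        using c[of F G] F G FG sub by (simp add: p_def flip: mult.assoc)
      then show ?thesis using cG[OF G] by (auto simp: zero_less_mult_iff)
    qed
    have "balanced (signed_incidence_graph L \<sigma> i)"
    proof (rule potential_balanced[where p = p])
      fix x y assume "{x, y} \<in> edges (signed_incidence_graph L \<sigma> i)"
      then show "of_int (edge_sign (signed_incidence_graph L \<sigma> i) {x, y}) * (p x * p y) > 0"
      proof (cases rule: edge_incidence_cases)
        case 1 then show ?thesis using key by (simp add: edge_sign_incidence)
      next
        case 2 then show ?thesis
          using key[OF 2] by (simp add: edge_sign_incidence insert_commute[of x] mult.commute[of "p x"])
      qed
    qed
    then show "\<exists>K'. face_path_component V K i K' \<and> balanced (signed_incidence_graph K' \<sigma> i)"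
      using L(1) by blast
  next

    \<comment> \<open>From a balanced component to an extremal function\<close>
    assume "\<exists>K'. face_path_component V K i K' \<and> balanced (signed_incidence_graph K' \<sigma> i)"
    then obtain L where L: "face_path_component V K i L" and bal: "balanced (signed_incidence_graph L \<sigma> i)"
      by blast
    let ?B = "signed_incidence_graph L \<sigma> i"
    let ?T = "faces L (i + 1)"
    \<comment> \<open>\<open>L\<close> can have \<open>i\<close>-faces below none of its
      \<open>(i+1)\<close>-faces. They are isolated in the graph, and \<open>f\<close> has to vanish
      there.\<close>
    let ?S = "{F \<in> faces L i. \<exists>G\<in>?T. F \<subset> G}"
    have sL: "simplicial_complex V L" and LK: "L \<subseteq> K" and conn: "face_path_connected L i"
      using L unfolding face_path_component_def by blast+
    have sub: "F \<in> faces K j" if "F \<in> faces L j" for F j using that faces_mono[OF LK] by blast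
    obtain G0 where G0: "G0 \<in> ?T" using component_nonempty[OF K ne(1) L] by blast
    have edge: "{F, G} \<in> edges ?B" "{G, F} \<in> edges ?B"
      if "F \<in> faces L i" "G \<in> ?T" "F \<subset> G" for F G
      using that unfolding edges_incidence by blast+
    obtain F1 where F1: "F1 \<in> faces L i" "F1 \<subset> G0"
    proof -
      have "card {F \<in> faces L i. F \<subset> G0} \<noteq> 0" using card_subfaces[OF sL G0] by simp
      then have "{F \<in> faces L i. F \<subset> G0} \<noteq> {}" by (metis card.empty)
      then show thesis using that by blast
    qed
    have reach: "\<exists>xs. graph_walk ?B (G0 # xs @ [G])" if G: "G \<in> ?T" for G
    proof -
      obtain Fs where Fs: "face_path L i Fs" "hd Fs = G0" "last Fs = G"
        by (rule face_path_connectedE[OF conn G0 G])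
      have "\<exists>xs. graph_walk ?B (G0 # xs @ [last Fs])"
      proof (rule face_path_induct[OF Fs(1)])
        \<comment> \<open>The required list has two ends, so \<open>G0\<close> reaches itself
          through \<open>F1\<close>.\<close>
        have "graph_walk ?B (G0 # [F1] @ [G0])" using edge[OF F1(1) G0 F1(2)] by simp
        then show "\<exists>xs. graph_walk ?B (G0 # xs @ [hd Fs])" using Fs(2) by blast
        fix G H assume GH: "G \<in> ?T" "H \<in> ?T" "G \<inter> H \<in> faces L i"
          and "\<exists>xs. graph_walk ?B (G0 # xs @ [G])"
        then obtain xs where xs: "graph_walk ?B (G0 # xs @ [G])" by blast
        note ps = Int_face_psubset[OF GH]
        have "graph_walk ?B (G0 # (xs @ [G, G \<inter> H]) @ [H])"
          using xs edge[OF GH(3,1) ps(1)] edge[OF GH(3,2) ps(2)]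
            successively_append_Cons[of _ "G0 # xs" G "[G \<inter> H, H]"] by simp
        then show "\<exists>xs. graph_walk ?B (G0 # xs @ [H])" by blast
      qed
      then show ?thesis using Fs(3) by simp
    qed
    have sq: "edge_sign ?B e * edge_sign ?B e = 1" if "e \<in> edges ?B" for e
      using that unfolding edges_incidence by (elim exE conjE) (simp add: edge_sign_incidence incidence_sgn_square)
    have verts: "x \<in> vertices ?B \<and> y \<in> vertices ?B \<and> x \<noteq> y" if "{x, y} \<in> edges ?B" for x y
      using that by (cases rule: edge_incidence_cases) (auto simp: signed_incidence_graph_def)
    have conn': "\<exists>xs. graph_walk ?B (G0 # xs @ [x])" if "x \<in> ?S \<union> ?T" for x
    proof (cases "x \<in> ?T")
      case False
      with that obtain G where G: "x \<in> faces L i" "G \<in> ?T" "x \<subset> G" by blast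
      obtain xs where "graph_walk ?B (G0 # xs @ [G])" using reach[OF G(2)] by blast
      then have "graph_walk ?B (G0 # (xs @ [G]) @ [x])"
        using edge[OF G] successively_append_Cons[of _ "G0 # xs" G "[x]"] by simp
      then show ?thesis by blast
    qed (rule reach)
    obtain p :: "'a set \<Rightarrow> int" where p: "\<And>x. x \<in> ?S \<union> ?T \<Longrightarrow> p x * p x = 1"
      and pe: "\<And>x y. x \<in> ?S \<union> ?T \<Longrightarrow> y \<in> ?S \<union> ?T \<Longrightarrow> {x, y} \<in> edges ?B \<Longrightarrow>
        edge_sign ?B {x, y} = p x * p y"
      by (rule balanced_potential[OF _ _ bal conn', of "?S \<union> ?T"]) (use sq verts in blast)+
    \<comment> \<open>The switching signs are extended by zero outside the component.\<close>
    define f where "f = (\<lambda>F. if F \<in> ?S then of_int (p F) else 0 :: real)"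
    define c where "c = (\<lambda>G. if G \<in> ?T then of_int (p G) else 0 :: real)"
    have F1S: "F1 \<in> ?S" using F1 G0 by blast
    then have "p F1 * p F1 = 1" by (rule p[OF UnI1])
    then have "p F1 \<noteq> 0" by auto
    then have "f F1 \<noteq> 0" using F1S by (simp only: f_def if_True of_int_eq_0_iff not_False_eq_True)
    then have "\<exists>F\<in>faces K i. f F \<noteq> 0" using F1 sub by blast
    \<comment> \<open>A face in \<open>?S\<close> lies properly in a face of \<open>K\<close>, so
      facets get the value 0.\<close>
    moreover have "f F = 0" if "facet K F" for F
      using that LK unfolding f_def facet_def faces_def by auto
    moreover have "?s F G * f F = c G" if F: "F \<in> faces K i" and G: "G \<in> faces K (i + 1)" and FG: "F \<subset> G" for F G
    proof (cases "G \<in> ?T")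
      case True
      then have FL: "F \<in> faces L i"
        using F FG simplicial_complex_subset[OF sL, of G F] by (auto simp: faces_def)
      then have FS: "F \<in> ?S" using True FG by blast
      have "incidence_sgn \<sigma> F G = p F * p G"
        using pe[OF UnI1[OF FS] UnI2[OF True] edge(1)[OF FL True FG]]
        unfolding edge_sign_incidence[OF FG] .
      then have "incidence_sgn \<sigma> F G * p F = p G" using p[OF UnI1[OF FS]] by simp
      then have "of_int (incidence_sgn \<sigma> F G * p F) = (of_int (p G) :: real)" by simp
      then show ?thesis using FS True by (simp only: f_def c_def if_True of_int_mult)
    next
      case False
      \<comment> \<open>Were \<open>F\<close> below a face of the component, \<open>G\<close> would
        belong to it too; hence both sides are 0.\<close>
      have "F \<notin> ?S" using component_neighbour[OF K L _ F _ FG G] False by blast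
      then show ?thesis using False by (simp only: f_def c_def if_False mult_zero_right)
    qed
    ultimately show "\<exists>f c. (\<exists>F\<in>faces K i. f F \<noteq> 0) \<and> (\<forall>F\<in>faces K i. facet K F \<longrightarrow> f F = 0) \<and>
      (\<forall>F\<in>faces K i. \<forall>G\<in>faces K (i + 1). F \<subset> G \<longrightarrow> ?s F G * f F = c G)"
      by - (rule exI[where x = f], rule exI[where x = c], simp)
  qed
qed

end
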